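(* Let $A\in\mathbb{R}^{M\times Q}$. Suppose that $y\mapsto\mu_\theta(y)=\Phi x_\theta(y)$ is weakly differentiable, so that its divergence is well defined in the weak sense. If $y=\Phi x_0+w$ with $w\sim\mathcal{N}(0,\sigma^2\operatorname{Id}_Q)$, then $$\mathbb{E}_w\,\mathrm{GSURE}^A(x_\theta(y))=\mathbb{E}_w\left(\|A\mu_0-A\mu_\theta(y)\|_2^2\right)\quad\text{and}\quad\mathbb{E}_w\,\widehat{df}^A_\theta(y)=df^A_\theta .$$
   Context: $\Phi\in\mathbb{R}^{Q\times N}$, $x_0\in\mathbb{R}^N$ is a fixed unknown vector, $\mu_0=\Phi x_0$, and $\sigma>0$. $x_\theta(y)$ is an arbitrary estimator of $x_0$ from $y\in\mathbb{R}^Q$, with parameters $\theta$, such that $\mu_\theta(y)=\Phi x_\theta(y)$ is a single-valued mapping $\mathbb{R}^Q\to\mathbb{R}^Q$. $\partial\mu_\theta(y)/\partial y$ is its (weak) Jacobian matrix, $A^*$ is the adjoint (transpose) of $A$, $\operatorname{tr}$ the trace, and $\mathbb{E}_w$, $\operatorname{cov}_w$ are expectation and covariance with respect to $w$. Define $$\widehat{df}^A_\theta(y)=\operatorname{tr}\left(A\frac{\partial\mu_\theta(y)}{\partial y}A^*\right),\qquad df^A_\theta=\sum_{i=1}^M\frac{\operatorname{cov}_w((Ay)_i,(A\mu_\theta(y))_i)}{\sigma^2},$$ $$\mathrm{GSURE}^A(x_\theta(y))=\|A(y-\mu_\theta(y))\|_2^2-\sigma^2\operatorname{tr}(A^*A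)+2\sigma^2\,\widehat{df}^A_\theta(y).$$
   Formalization: The formal statement additionally assumes that the expectation of the estimated degrees of freedom and the covariances defining df exist (are finite); weak differentiability alone does not guarantee this, e.g. Q=1, mu(y)=sin(exp(y^2)), sigma=1. *)

theory Defs
  imports "HOL-Probability.Probability"
begin

text \<open>
  The centred normal distribution with covariance matrix \<open>\<sigma>\<^sup>2 Id\<close> enters through its Lebesgue density.
\<close>

definition isotropic_normal_density :: "real \<Rightarrow> real ^ 'q \<Rightarrow> real" where
  "isotropic_normal_density \<sigma> v =
     exp (- (norm v)\<^sup>2 / (2 * \<sigma>\<^sup>2)) / sqrt (2 * pi * \<sigma>\<^sup>2) ^ CARD('q)"

definition cov :: "'w measure \<Rightarrow> ('w \<Rightarrow> real) \<Rightarrow> ('w \<Rightarrow> real) \<Rightarrow> real" where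
  "cov M X Y = (LINT \<omega>|M. (X \<omega> - (LINT \<omega>'|M. X \<omega>')) * (Y \<omega> - (LINT \<omega>'|M. Y \<omega>')))"

definition partial_deriv :: "'q::finite \<Rightarrow> (real ^ 'q \<Rightarrow> real) \<Rightarrow> real ^ 'q \<Rightarrow> real" where
  "partial_deriv j f v = frechet_derivative f (at v) (axis j 1)"

text \<open>
  The conjunct \<open>f differentiable_on UNIV\<close> keeps \<open>frechet_derivative\<close>, which is a choice
  operator, meaningful in \<open>partial_deriv\<close>.
\<close>

primrec C_k :: "nat \<Rightarrow> (real ^ 'q::finite \<Rightarrow> real) \<Rightarrow> bool" where
  "C_k 0 f \<longleftrightarrow> continuous_on UNIV f"
| "C_k (Suc k) f \<longleftrightarrow> f differentiable_on UNIV \<and> (\<forall>j. C_k k (partial_deriv j f))"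

definition test_function :: "(real ^ 'q::finite \<Rightarrow> real) \<Rightarrow> bool" where
  "test_function \<phi> \<longleftrightarrow> (\<forall>k. C_k k \<phi>) \<and> compact (closure {v. \<phi> v \<noteq> 0})"

text \<open>
  Integrability over \<open>lborel\<close> includes Borel measurability, so functions that are locally
  integrable are Borel representatives of their almost-everywhere classes.
\<close>

definition locally_integrable :: "(real ^ 'q::finite \<Rightarrow> real) \<Rightarrow> bool" where
  "locally_integrable f \<longleftrightarrow> (\<forall>K. compact K \<longrightarrow> set_integrable lborel K f)"

definition has_weak_partial_deriv ::
    "(real ^ 'q::finite \<Rightarrow> real) \<Rightarrow> 'q \<Rightarrow> (real ^ 'q \<Rightarrow> real) \<Rightarrow> bool" where
  "has_weak_partial_deriv f j g \<longleftrightarrow>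
     locally_integrable f \<and> locally_integrable g \<and>
     (\<forall>\<phi>. test_function \<phi> \<longrightarrow>
        (LINT v|lborel. f v * partial_deriv j \<phi> v) = - (LINT v|lborel. g v * \<phi> v))"

definition has_weak_jacobian ::
    "(real ^ 'q::finite \<Rightarrow> real ^ 'p::finite) \<Rightarrow> (real ^ 'q \<Rightarrow> real ^ 'q ^ 'p) \<Rightarrow> bool" where
  "has_weak_jacobian \<mu> J \<longleftrightarrow>
     (\<forall>i j. has_weak_partial_deriv (\<lambda>v. \<mu> v $ i) j (\<lambda>v. J v $ i $ j))"

text \<open>
  A weak Jacobian is determined only almost everywhere, so the estimator of the degrees of
  freedom and the risk estimate take a version \<open>J\<close> of it as an argument.
\<close>

definition df_hat ::
    "real ^ 'q ^ 'm \<Rightarrow> (real ^ 'q \<Rightarrow> real ^ 'q ^ 'q) \<Rightarrow> real ^ 'q \<Rightarrow> real" where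
  "df_hat A J v = trace (A ** J v ** transpose A)"

definition df ::
    "real \<Rightarrow> real ^ 'q ^ 'm \<Rightarrow> (real ^ 'q \<Rightarrow> real ^ 'q) \<Rightarrow> 'w measure \<Rightarrow> ('w \<Rightarrow> real ^ 'q) \<Rightarrow> real" where
  "df \<sigma> A \<mu> M y =
     (\<Sum>i\<in>UNIV. cov M (\<lambda>\<omega>. (A *v y \<omega>) $ i) (\<lambda>\<omega>. (A *v \<mu> (y \<omega>)) $ i) / \<sigma>\<^sup>2)"

definition GSURE ::
    "real \<Rightarrow> real ^ 'q ^ 'm \<Rightarrow> (real ^ 'q \<Rightarrow> real ^ 'q) \<Rightarrow> (real ^ 'q \<Rightarrow> real ^ 'q ^ 'q) \<Rightarrow>
     real ^ 'q \<Rightarrow> real" where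
  "GSURE \<sigma> A \<mu> J v =
     (norm (A *v (v - \<mu> v)))\<^sup>2 - \<sigma>\<^sup>2 * trace (transpose A ** A) + 2 * \<sigma>\<^sup>2 * df_hat A J v"

end

theory Submission
  imports Defs "HOL-Computational_Algebra.Polynomial"
begin

text \<open>
  Everything rests on Stein's identity. Let \<open>g\<close> be the density of \<open>y\<close>. Since
  \<open>\<nabla>g(v) = - g(v) (v - \<mu>\<^sub>0) / \<sigma>\<^sup>2\<close>, testing the weak divergence of a vector field \<open>F\<close> against \<open>g\<close>
  turns the expectation of \<open>div F\<close> into that of \<open>(y - \<mu>\<^sub>0) \<bullet> F(y) / \<sigma>\<^sup>2\<close>. For
  \<open>F = A\<^sup>* A \<mu>\<close> the divergence is \<open>trace (A\<^sup>* A J) = trace (A J A\<^sup>*)\<close>, the estimated degrees of freedom,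
  while \<open>(y - \<mu>\<^sub>0) \<bullet> F(y) = (A w) \<bullet> (A \<mu>(y))\<close>, whose expectation is \<open>\<sigma>\<^sup>2\<close> times the
  degrees of freedom because \<open>A w\<close> is centred.

  The density \<open>g\<close> is not a test function, as it lacks compact support. It is replaced by
  \<open>g(v) h(c |v - \<mu>\<^sub>0|\<^sup>2)\<close> with \<open>h\<close> smooth, vanishing on \<open>[1, \<infinity>)\<close> and positive at \<open>0\<close>, and \<open>c\<close> tends
  to \<open>0\<close> (\<open>weak_stein_identity\<close>). As the cutoff is radial, its gradient is again a multiple of
  \<open>v - \<mu>\<^sub>0\<close>; thus the two sides are dominated by multiples of \<open>g (v - \<mu>\<^sub>0) \<bullet> F\<close> and \<open>g div F\<close>,
  whose integrability is the existence of the expectations in question. Single entries of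
  \<open>J\<close> may fail to be integrable against \<open>g\<close>, so the identity is proved for the divergence as a whole.

  For the risk, expanding the square around \<open>A \<mu>\<^sub>0 - A \<mu>(y)\<close> writes \<open>GSURE\<close> as
  \<open>|A \<mu>\<^sub>0 - A \<mu>(y)|\<^sup>2 + Z\<close>, where \<open>Z\<close> is integrable with mean zero by Stein's identity and the first two
  moments of the noise. Hence the risk estimate and the loss are integrable together, and if they
  are not, both integrals are \<open>0\<close> by convention.
\<close>

section \<open>Calculus of \<open>C_k\<close> functions\<close>

lemma partial_deriv_eq:
  assumes "(f has_derivative f') (at v)"
  shows "partial_deriv j f v = f' (axis j 1)"
  using frechet_derivative_at[OF assms] by (simp add: partial_deriv_def)

lemma differentiable_on_UNIV_has_derivative:
  assumes "f differentiable_on UNIV"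
  shows "(f has_derivative frechet_derivative f (at v)) (at v)"
  using assms by (simp add: differentiable_on_def frechet_derivative_works)

lemma C_k_Suc_imp_C_k: "C_k (Suc k) f \<Longrightarrow> C_k k f"
proof (induction k arbitrary: f)
  case 0
  then show ?case by (simp add: differentiable_imp_continuous_on)
next
  case (Suc k)
  then show ?case by (metis C_k.simps(2))
qed

lemma C_k_const: "C_k k (\<lambda>v :: real ^ 'q. c)"
proof (induction k arbitrary: c)
  case (Suc k)
  have "partial_deriv j (\<lambda>v :: real ^ 'q. c) = (\<lambda>v. 0)" for j
    by (rule ext) (simp add: partial_deriv_eq[OF has_derivative_const])
  with Suc show ?case by simp
qed simp

lemma C_k_component: "C_k k (\<lambda>v. v $ i)"
proof (cases k)
  case (Suc l)
  have D: "((\<lambda>v. v $ i) has_derivative (\<lambda>v. v $ i)) (at v)" for v :: "real ^ 'a"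
    by (rule bounded_linear_imp_has_derivative) (rule bounded_linear_vec_nth)
  have "partial_deriv j (\<lambda>v. v $ i) = (\<lambda>v. axis j 1 $ i)" for j
    by (rule ext) (rule partial_deriv_eq[OF D])
  with D show ?thesis
    by (auto simp: Suc differentiable_on_def differentiable_def C_k_const)
qed (auto intro: continuous_intros)

lemma C_k_add: "C_k k f \<Longrightarrow> C_k k g \<Longrightarrow> C_k k (\<lambda>v. f v + g v)"
proof (induction k arbitrary: f g)
  case 0
  then show ?case by (auto intro: continuous_intros)
next
  case (Suc k)
  then have df: "f differentiable_on UNIV" and dg: "g differentiable_on UNIV" by auto
  have "partial_deriv j (\<lambda>v. f v + g v) = (\<lambda>v. partial_deriv j f v + partial_deriv j g v)" for j
    by (rule ext, subst partial_deriv_eq[OF has_derivative_add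
          [OF differentiable_on_UNIV_has_derivative[OF df]
              differentiable_on_UNIV_has_derivative[OF dg]]])
       (simp add: partial_deriv_def)
  with Suc df dg show ?case by (auto intro: differentiable_on_add)
qed

lemma C_k_mult: "C_k k f \<Longrightarrow> C_k k g \<Longrightarrow> C_k k (\<lambda>v. f v * g v)"
proof (induction k arbitrary: f g)
  case 0
  then show ?case by (auto intro: continuous_intros)
next
  case (Suc k)
  then have df: "f differentiable_on UNIV" and dg: "g differentiable_on UNIV" by auto
  have "partial_deriv j (\<lambda>v. f v * g v) =
      (\<lambda>v. f v * partial_deriv j g v + partial_deriv j f v * g v)" for j
    by (rule ext, subst partial_deriv_eq[OF has_derivative_mult
          [OF differentiable_on_UNIV_has_derivative[OF df]
              differentiable_on_UNIV_has_derivative[OF dg]]])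
       (simp add: partial_deriv_def)
  moreover have "C_k k f" "C_k k g"
    using Suc.prems C_k_Suc_imp_C_k by blast+
  ultimately show ?case
    using Suc df dg by (auto intro!: differentiable_on_mult C_k_add)
qed

lemma C_k_sum: "finite I \<Longrightarrow> (\<And>i. i \<in> I \<Longrightarrow> C_k k (f i)) \<Longrightarrow> C_k k (\<lambda>v. \<Sum>i\<in>I. f i v)"
  by (induction I rule: finite_induct) (auto intro: C_k_const C_k_add)

text \<open>
  A smooth outer function enters as the sequence \<open>D\<close> of its derivatives, which avoids iterated
  choices of derivatives: the chain rule replaces \<open>D n \<circ> f\<close> by \<open>D (Suc n) \<circ> f\<close> times a factor of
  lower order, so the induction runs over all \<open>n\<close> at once.
\<close>

lemma C_k_compose:
  assumes D: "\<And>n t. (D n has_real_derivative D (Suc n) t) (at t)"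
  shows "C_k k f \<Longrightarrow> C_k k (\<lambda>v. D n (f v))"
proof (induction k arbitrary: f n)
  case 0
  have "continuous_on UNIV (D n)"
    using D by (meson DERIV_continuous_on has_field_derivative_at_within)
  with 0 show ?case
    by (auto intro: continuous_on_compose2)
next
  case (Suc k)
  then have df: "f differentiable_on UNIV" by auto
  have chain: "((\<lambda>v. D n (f v)) has_derivative
      (\<lambda>h. D (Suc n) (f v) * frechet_derivative f (at v) h)) (at v)" for v
    using has_derivative_compose[OF differentiable_on_UNIV_has_derivative[OF df]
        D[unfolded has_field_derivative_def]] by (simp add: mult.commute)
  have "partial_deriv j (\<lambda>v. D n (f v)) = (\<lambda>v. D (Suc n) (f v) * partial_deriv j f v)" for j
    by (rule ext, subst partial_deriv_eq[OF chain]) (simp add: partial_deriv_def)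
  moreover have "(\<lambda>v. D n (f v)) differentiable_on UNIV"
    using chain by (auto simp: differentiable_on_def differentiable_def)
  ultimately show ?case
    using Suc C_k_Suc_imp_C_k[OF Suc.prems] by (auto intro!: C_k_mult)
qed

lemma C_k_norm_square: "C_k k (\<lambda>v. (norm (v - a))\<^sup>2)"
proof -
  have "C_k k (\<lambda>v. \<Sum>j\<in>UNIV. (v $ j + - a $ j) * (v $ j + - a $ j))"
    by (intro C_k_sum C_k_mult C_k_add C_k_component C_k_const) auto
  then show ?thesis
    by (simp add: power2_norm_eq_inner inner_vec_def)
qed

section \<open>A smooth cutoff profile\<close>

text \<open>
  The classical flat function \<open>exp (- 1 / t)\<close> and its derivatives: polynomial multiples in \<open>1 / t\<close>
  form a class closed under differentiation. In \<open>flat_exp_deriv\<close> the factor \<open>[:0, 0, 1:]\<close>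
  stems from the inner derivative of \<open>1 / t\<close>.
\<close>

definition flat_exp :: "real poly \<Rightarrow> real \<Rightarrow> real" where
  "flat_exp p t = (if t > 0 then poly p (inverse t) * exp (- inverse t) else 0)"

definition flat_exp_deriv :: "real poly \<Rightarrow> real poly" where
  "flat_exp_deriv p = [:0, 0, 1:] * (p - pderiv p)"

lemma poly_times_exp_minus_tendsto_0: "((\<lambda>u. poly p u * exp (- u)) \<longlongrightarrow> 0) (at_top :: real filter)"
proof -
  have "((\<lambda>u. \<Sum>i\<le>degree p. coeff p i * (u ^ i / exp u)) \<longlongrightarrow> (\<Sum>i\<le>degree p. coeff p i * 0)) at_top"
    by (intro tendsto_sum tendsto_mult tendsto_const tendsto_power_div_exp_0)
  then show ?thesis
    by (simp add: poly_altdef sum_distrib_right exp_minus divide_inverse mult.assoc)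
qed

text \<open>
  At \<open>0\<close> the difference quotient from the right is again of the form \<open>poly q u * exp (- u)\<close> with
  \<open>u = 1 / t\<close> tending to infinity, hence tends to \<open>0\<close>.
\<close>

lemma flat_exp_has_derivative: "(flat_exp p has_real_derivative flat_exp (flat_exp_deriv p) t) (at t)"
proof -
  consider "t > 0" | "t < 0" | "t = 0" by linarith
  then show ?thesis
  proof cases
    case 1
    have "((\<lambda>t. poly p (inverse t) * exp (- inverse t)) has_real_derivative
        flat_exp (flat_exp_deriv p) t) (at t)"
      using 1 by (auto intro!: derivative_eq_intros simp: flat_exp_def flat_exp_deriv_def algebra_simps power2_eq_square)
    then show ?thesis
      by (rule has_field_derivative_transform_within_open[where S = "{0<..}"])
         (use 1 in \<open>auto simp: flat_exp_def\<close>)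
  next
    case 2
    have "((\<lambda>t. 0) has_real_derivative flat_exp (flat_exp_deriv p) t) (at t)"
      using 2 by (simp add: flat_exp_def)
    then show ?thesis
      by (rule has_field_derivative_transform_within_open[where S = "{..<0}"])
         (use 2 in \<open>auto simp: flat_exp_def\<close>)
  next
    case 3
    have "((\<lambda>h. poly ([:0, 1:] * p) (inverse h) * exp (- inverse h)) \<longlongrightarrow> 0) (at_right (0::real))"
      using filterlim_compose[OF poly_times_exp_minus_tendsto_0 filterlim_inverse_at_top_right] .
    then have "((\<lambda>h. flat_exp p h / h) \<longlongrightarrow> 0) (at_right 0)"
      by (rule Lim_transform_eventually)
         (auto simp: eventually_at_right_less flat_exp_def field_simps intro: eventually_mono[OF eventually_at_right_less])
    moreover have "((\<lambda>h. flat_exp p h / h) \<longlongrightarrow> 0) (at_left 0)"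
      by (rule Lim_transform_eventually[OF tendsto_const])
         (auto simp: flat_exp_def eventually_at_filter)
    ultimately have "((\<lambda>h. flat_exp p h / h) \<longlongrightarrow> 0) (at 0)"
      by (simp add: filterlim_at_split)
    then show ?thesis
      using 3 by (simp add: DERIV_def flat_exp_def)
  qed
qed

lemma continuous_flat_exp: "continuous_on S (flat_exp p)"
  using flat_exp_has_derivative by (meson DERIV_continuous_on has_field_derivative_at_within)

text \<open>
  Compactness of \<open>[0, 1]\<close> gives the bound, as the function vanishes to the left of it. The cutoff
  below only evaluates it at arguments \<open>1 - c * (norm (v - a))\<^sup>2\<close>, which never exceed \<open>1\<close>.
\<close>

lemma flat_exp_bounded: "\<exists>C\<ge>0. \<forall>t\<le>1. \<bar>flat_exp p t\<bar> \<le> C"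
proof -
  have "compact (flat_exp p ` {0..1})"
    by (intro compact_continuous_image continuous_flat_exp) auto
  then obtain C where C: "\<And>x. x \<in> flat_exp p ` {0..1} \<Longrightarrow> norm x \<le> C"
    by (meson bounded_iff compact_imp_bounded)
  have "\<bar>flat_exp p t\<bar> \<le> \<bar>C\<bar>" if "t \<le> 1" for t
  proof (cases "t > 0")
    case True
    then show ?thesis using C[of "flat_exp p t"] that by auto
  qed (simp add: flat_exp_def)
  then show ?thesis by (intro exI[of _ "\<bar>C\<bar>"]) auto
qed

section \<open>Weak divergence\<close>

text \<open>
  The entries of a weak Jacobian may fail to be integrable against a Gaussian even if its trace is
  integrable against it. The divergence is therefore tested as a whole.
\<close>

definition has_weak_divergence ::
    "(real ^ 'q::finite \<Rightarrow> real ^ 'q) \<Rightarrow> (real ^ 'q \<Rightarrow> real) \<Rightarrow> bool" where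
  "has_weak_divergence F d \<longleftrightarrow>
     (\<forall>j. locally_integrable (\<lambda>v. F v $ j)) \<and> locally_integrable d \<and>
     (\<forall>\<phi>. test_function \<phi> \<longrightarrow>
        (LINT v|lborel. F v \<bullet> (\<chi> j. partial_deriv j \<phi> v)) = - (LINT v|lborel. d v * \<phi> v))"

lemma test_function_C_k: "test_function \<phi> \<Longrightarrow> C_k k \<phi>"
  by (simp add: test_function_def)

lemma test_function_continuous:
  assumes "test_function \<phi>"
  shows "continuous_on UNIV \<phi>" "continuous_on UNIV (partial_deriv j \<phi>)"
  using test_function_C_k[OF assms, of 0] test_function_C_k[OF assms, of "Suc 0"] by auto

lemma partial_deriv_eq_0_outside_support:
  assumes "v \<notin> closure {v. \<phi> v \<noteq> 0}"
  shows "partial_deriv j \<phi> v = 0"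
proof -
  have "((\<lambda>v. 0) has_derivative (\<lambda>h. 0)) (at v)"
    by simp
  then have "(\<phi> has_derivative (\<lambda>h. 0)) (at v)"
    by (rule has_derivative_transform_within_open[where s = "- closure {v. \<phi> v \<noteq> 0}"])
       (use assms closure_subset[of "{v. \<phi> v \<noteq> 0}"] in auto)
  from partial_deriv_eq[OF this] show ?thesis .
qed

lemma locally_integrable_mult_continuous:
  assumes f: "locally_integrable f" and K: "compact K"
    and \<psi>: "continuous_on UNIV \<psi>" "\<And>v. v \<notin> K \<Longrightarrow> \<psi> v = 0"
  shows "integrable lborel (\<lambda>v. f v * \<psi> v)"
proof -
  have fK: "integrable lborel (\<lambda>v. indicator K v *\<^sub>R f v)"
    using f K by (simp add: locally_integrable_def set_integrable_def)
  have "compact (\<psi> ` K)"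
    using K \<psi>(1) by (intro compact_continuous_image) (auto intro: continuous_on_subset)
  then obtain C where C: "\<And>v. v \<in> K \<Longrightarrow> norm (\<psi> v) \<le> C"
    by (meson bounded_iff compact_imp_bounded imageI)
  have [measurable]: "\<psi> \<in> borel_measurable borel"
    using \<psi>(1) by (rule borel_measurable_continuous_onI)
  have "integrable lborel (\<lambda>v. (indicator K v *\<^sub>R f v) * \<psi> v)"
  proof (rule Bochner_Integration.integrable_bound)
    show "integrable lborel (\<lambda>v. C * norm (indicator K v *\<^sub>R f v))"
      using fK by (intro integrable_mult_right integrable_norm)
    show "(\<lambda>v. (indicator K v *\<^sub>R f v) * \<psi> v) \<in> borel_measurable lborel"
      using borel_measurable_integrable[OF fK] by measurable
    show "AE v in lborel. norm (indicator K v *\<^sub>R f v * \<psi> v)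
        \<le> norm (C * norm (indicator K v *\<^sub>R f v))"
    proof (intro AE_I2)
      fix v show "norm (indicator K v *\<^sub>R f v * \<psi> v) \<le> norm (C * norm (indicator K v *\<^sub>R f v))"
        using C[of v] order_trans[OF norm_ge_zero C, of v]
        by (cases "v \<in> K") (auto simp: abs_mult mult.commute intro: mult_right_mono)
    qed
  qed
  moreover have "(\<lambda>v. (indicator K v *\<^sub>R f v) * \<psi> v) = (\<lambda>v. f v * \<psi> v)"
    using \<psi>(2) by (auto simp: fun_eq_iff indicator_def)
  ultimately show ?thesis by simp
qed

lemma locally_integrable_measurable:
  fixes f :: "real ^ 'q::finite \<Rightarrow> real"
  assumes "locally_integrable f"
  shows "f \<in> borel_measurable borel"
proof (rule borel_measurable_LIMSEQ_real)
  fix n :: nat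
  have "set_integrable lborel (cball 0 (real n)) f"
    using assms by (simp add: locally_integrable_def)
  then show "(\<lambda>v. indicator (cball 0 (real n)) v *\<^sub>R f v) \<in> borel_measurable borel"
    unfolding set_integrable_def using borel_measurable_integrable by fastforce
next
  fix v :: "real ^ 'q"
  obtain N :: nat where "norm v \<le> real N"
    using real_arch_simple by blast
  then show "(\<lambda>n. indicator (cball 0 (real n)) v *\<^sub>R f v) \<longlonglongrightarrow> f v"
    by (intro tendsto_eventually eventually_sequentiallyI[of N]) (auto simp: indicator_def)
qed

lemma has_weak_divergence_measurable:
  assumes "has_weak_divergence F d"
  shows "F \<in> borel_measurable borel" "d \<in> borel_measurable borel"
proof -
  have "(\<lambda>v. F v $ j) \<in> borel_measurable borel" for j
    using assms by (intro locally_integrable_measurable) (simp add: has_weak_divergence_def)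
  then show "F \<in> borel_measurable borel"
    by (subst borel_measurable_euclidean_space) (auto simp: Basis_vec_def inner_axis)
  show "d \<in> borel_measurable borel"
    using assms by (intro locally_integrable_measurable) (simp add: has_weak_divergence_def)
qed

lemma locally_integrable_linear_combination:
  fixes f :: "'i \<Rightarrow> real ^ 'q::finite \<Rightarrow> real"
  assumes "\<And>i. i \<in> I \<Longrightarrow> locally_integrable (f i)"
  shows "locally_integrable (\<lambda>v. \<Sum>i\<in>I. c i * f i v)"
  unfolding locally_integrable_def set_integrable_def scaleR_sum_right
proof (intro allI impI Bochner_Integration.integrable_sum)
  fix K :: "(real ^ 'q) set" and i
  assume "compact K" "i \<in> I"
  then have "integrable lborel (\<lambda>v. indicator K v *\<^sub>R f i v)"
    using assms by (simp add: locally_integrable_def set_integrable_def)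
  then have "integrable lborel (\<lambda>v. c i * (indicator K v *\<^sub>R f i v))"
    by (rule integrable_mult_right)
  then show "integrable lborel (\<lambda>v. indicator K v *\<^sub>R (c i * f i v))"
    by (simp add: mult.left_commute)
qed

text \<open>
  Testing the entry \<open>(k, j)\<close> of \<open>J\<close> with weight \<open>B $ j $ k\<close> and summing gives the claim. The sums
  may be moved inside the integrals because each product with a test function is integrable.
\<close>

lemma has_weak_jacobian_imp_has_weak_divergence:
  fixes \<mu> :: "real ^ 'q::finite \<Rightarrow> real ^ 'q" and B :: "real ^ 'q ^ 'q"
  assumes "has_weak_jacobian \<mu> J"
  shows "has_weak_divergence (\<lambda>v. B *v \<mu> v) (\<lambda>v. trace (B ** J v))"
proof -
  have li: "locally_integrable (\<lambda>v. \<mu> v $ k)" "locally_integrable (\<lambda>v. J v $ k $ j)" for j k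
    using assms by (auto simp: has_weak_jacobian_def has_weak_partial_deriv_def)
  have "(LINT v|lborel. (B *v \<mu> v) \<bullet> (\<chi> j. partial_deriv j \<phi> v)) =
      - (LINT v|lborel. trace (B ** J v) * \<phi> v)" if \<phi>: "test_function \<phi>" for \<phi>
  proof -
    let ?K = "closure {v. \<phi> v \<noteq> 0}"
    have K: "compact ?K" using \<phi> by (simp add: test_function_def)
    have out: "\<phi> v = 0" if "v \<notin> ?K" for v
      using that closure_subset[of "{v. \<phi> v \<noteq> 0}"] by auto
    have int: "integrable lborel (\<lambda>v. \<mu> v $ k * partial_deriv j \<phi> v)"
      "integrable lborel (\<lambda>v. J v $ k $ j * \<phi> v)" for j k
      using locally_integrable_mult_continuous[OF li(1) K test_function_continuous(2)[OF \<phi>]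
          partial_deriv_eq_0_outside_support]
        locally_integrable_mult_continuous[OF li(2) K test_function_continuous(1)[OF \<phi>] out]
      by auto
    have "(LINT v|lborel. (B *v \<mu> v) \<bullet> (\<chi> j. partial_deriv j \<phi> v)) =
        (LINT v|lborel. (\<Sum>j\<in>UNIV. \<Sum>k\<in>UNIV. B $ j $ k * (\<mu> v $ k * partial_deriv j \<phi> v)))"
      by (simp add: inner_vec_def matrix_vector_mult_def sum_distrib_right mult.assoc)
    also have "\<dots> = (\<Sum>j\<in>UNIV. \<Sum>k\<in>UNIV. B $ j $ k * (LINT v|lborel. \<mu> v $ k * partial_deriv j \<phi> v))"
      using int(1) by (simp add: Bochner_Integration.integral_sum)
    also have "\<dots> = (\<Sum>j\<in>UNIV. \<Sum>k\<in>UNIV. B $ j $ k * - (LINT v|lborel. J v $ k $ j * \<phi> v))"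
      using assms \<phi> by (simp add: has_weak_jacobian_def has_weak_partial_deriv_def)
    also have "\<dots> = - (\<Sum>j\<in>UNIV. \<Sum>k\<in>UNIV. B $ j $ k * (LINT v|lborel. J v $ k $ j * \<phi> v))"
      by (simp add: sum_negf)
    also have "\<dots> = - (LINT v|lborel. (\<Sum>j\<in>UNIV. \<Sum>k\<in>UNIV. B $ j $ k * (J v $ k $ j * \<phi> v)))"
      using int(2) by (simp add: Bochner_Integration.integral_sum)
    also have "\<dots> = - (LINT v|lborel. trace (B ** J v) * \<phi> v)"
      by (simp add: trace_def matrix_matrix_mult_def sum_distrib_right mult.assoc)
    finally show ?thesis .
  qed
  moreover have "locally_integrable (\<lambda>v. (B *v \<mu> v) $ j)" for j
    unfolding matrix_vector_mult_def vec_lambda_beta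
    by (intro locally_integrable_linear_combination li)
  moreover have "locally_integrable (\<lambda>v. trace (B ** J v))"
  proof -
    have "locally_integrable (\<lambda>v. \<Sum>j\<in>UNIV. 1 * (\<Sum>k\<in>UNIV. B $ j $ k * J v $ k $ j))"
      by (intro locally_integrable_linear_combination li)
    then show ?thesis
      by (simp add: trace_def matrix_matrix_mult_def)
  qed
  ultimately show ?thesis
    by (simp add: has_weak_divergence_def)
qed

section \<open>Stein's identity for weakly differentiable vector fields\<close>

text \<open>
  The Gaussian centred at \<open>a\<close>, cut off at radius \<open>1 / sqrt c\<close>. The cutoff factor has no
  plateau: as \<open>c\<close> tends to \<open>0\<close> it converges pointwise to the constant \<open>flat_exp 1 1 = exp (- 1)\<close>, which cancels in the end.
\<close>

definition gaussian_cutoff :: "real \<Rightarrow> real ^ 'q \<Rightarrow> real \<Rightarrow> real ^ 'q \<Rightarrow> real" where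
  "gaussian_cutoff \<sigma> a c v =
     isotropic_normal_density \<sigma> (v - a) * flat_exp 1 (1 - c * (norm (v - a))\<^sup>2)"

lemma test_function_gaussian_cutoff:
  fixes a :: "real ^ 'q::finite"
  assumes "c > 0"
  shows "test_function (gaussian_cutoff \<sigma> a c)"
proof -
  have "C_k k (\<lambda>v. exp (- (1 / (2 * \<sigma>\<^sup>2)) * (norm (v - a))\<^sup>2))" for k
    by (rule C_k_compose[where D = "\<lambda>n. exp"])
       (intro DERIV_exp C_k_mult C_k_const C_k_norm_square)+
  moreover have "C_k k (\<lambda>v. flat_exp ((flat_exp_deriv ^^ 0) 1) (1 + - c * (norm (v - a))\<^sup>2))" for k
    by (rule C_k_compose[where D = "\<lambda>n. flat_exp ((flat_exp_deriv ^^ n) 1)"])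
       (simp, rule flat_exp_has_derivative, intro C_k_add C_k_mult C_k_const C_k_norm_square)
  ultimately have "C_k k (\<lambda>v. (1 / sqrt (2 * pi * \<sigma>\<^sup>2) ^ CARD('q) *
      exp (- (1 / (2 * \<sigma>\<^sup>2)) * (norm (v - a))\<^sup>2)) *
      flat_exp ((flat_exp_deriv ^^ 0) 1) (1 + - c * (norm (v - a))\<^sup>2))" for k
    by (intro C_k_mult C_k_const)
  then have "C_k k (gaussian_cutoff \<sigma> a c)" for k
    by (simp add: gaussian_cutoff_def[abs_def] isotropic_normal_density_def)
  moreover have "compact (closure {v. gaussian_cutoff \<sigma> a c v \<noteq> 0})"
  proof -
    have "norm (v - a) \<le> sqrt (1 / c)" if "gaussian_cutoff \<sigma> a c v \<noteq> 0" for v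
    proof -
      have "1 - c * (norm (v - a))\<^sup>2 > 0"
        using that by (auto simp: gaussian_cutoff_def flat_exp_def split: if_splits)
      then have "(norm (v - a))\<^sup>2 \<le> 1 / c"
        using assms by (simp add: field_simps)
      then show ?thesis by (rule real_le_rsqrt)
    qed
    then have "{v. gaussian_cutoff \<sigma> a c v \<noteq> 0} \<subseteq> cball a (sqrt (1 / c))"
      by (auto simp: dist_norm norm_minus_commute)
    then show ?thesis
      using bounded_cball bounded_subset compact_closure by metis
  qed
  ultimately show ?thesis by (simp add: test_function_def)
qed

text \<open>
  The whole gradient is a scalar multiple of \<open>v - a\<close>. This is the reason for a radial cutoff:
  the error term carries the same inner product \<open>(v - a) \<bullet> F v\<close> as the main term.
\<close>

lemma partial_deriv_gaussian_cutoff: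
  fixes a :: "real ^ 'q::finite"
  assumes "\<sigma> > 0"
  shows "partial_deriv j (gaussian_cutoff \<sigma> a c) v =
     isotropic_normal_density \<sigma> (v - a) * (v $ j - a $ j) *
     (- flat_exp 1 (1 - c * (norm (v - a))\<^sup>2) / \<sigma>\<^sup>2
        - 2 * c * flat_exp (flat_exp_deriv 1) (1 - c * (norm (v - a))\<^sup>2))"
proof -
  let ?s = "\<lambda>v. (norm (v - a))\<^sup>2"
  have s: "(?s has_derivative (\<lambda>h. 2 * ((v - a) \<bullet> h))) (at v)"
    unfolding power2_norm_eq_inner
    by (auto intro!: derivative_eq_intros simp: inner_commute)
  let ?N = "sqrt (2 * pi * \<sigma>\<^sup>2) ^ CARD('q)"
  have "((\<lambda>s. exp (- s / (2 * \<sigma>\<^sup>2)) / ?N * flat_exp 1 (1 - c * s)) has_real_derivative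
      exp (- ?s v / (2 * \<sigma>\<^sup>2)) / ?N * (- flat_exp 1 (1 - c * ?s v) / (2 * \<sigma>\<^sup>2)
        - c * flat_exp (flat_exp_deriv 1) (1 - c * ?s v))) (at (?s v))"
    using assms
    by (auto intro!: derivative_eq_intros DERIV_chain2[OF flat_exp_has_derivative] simp: field_simps)
  from has_derivative_compose[OF s this[unfolded has_field_derivative_def]]
  have "(gaussian_cutoff \<sigma> a c has_derivative
      (\<lambda>h. exp (- ?s v / (2 * \<sigma>\<^sup>2)) / ?N * (- flat_exp 1 (1 - c * ?s v) / (2 * \<sigma>\<^sup>2)
        - c * flat_exp (flat_exp_deriv 1) (1 - c * ?s v)) * (2 * ((v - a) \<bullet> h)))) (at v)"
    by (simp add: gaussian_cutoff_def[abs_def] isotropic_normal_density_def)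
  from partial_deriv_eq[OF this, of j] show ?thesis
    using assms by (simp add: inner_axis isotropic_normal_density_def field_simps)
qed

lemma continuous_isotropic_normal_density:
  "continuous_on UNIV (isotropic_normal_density \<sigma> :: real ^ 'q::finite \<Rightarrow> real)"
  unfolding isotropic_normal_density_def[abs_def] divide_inverse by (intro continuous_intros)

lemma isotropic_normal_density_nonneg: "isotropic_normal_density \<sigma> v \<ge> 0"
  by (simp add: isotropic_normal_density_def)

text \<open>
  Test the divergence with \<open>gaussian_cutoff \<sigma> a c\<close> and let \<open>c\<close> tend to \<open>0\<close>. The gradient of the cutoff
  contributes a term with the factor \<open>2 * c\<close>, and the derivative of the cutoff profile is bounded,
  so this term is dominated by a multiple of \<open>g (v - a) \<bullet> F v\<close> and disappears in the limit.
\<close>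

lemma weak_stein_identity:
  fixes F :: "real ^ 'q::finite \<Rightarrow> real ^ 'q"
  assumes \<sigma>: "\<sigma> > 0" and F: "has_weak_divergence F d"
    and int_F: "integrable lborel (\<lambda>v. isotropic_normal_density \<sigma> (v - a) * ((v - a) \<bullet> F v))"
    and int_d: "integrable lborel (\<lambda>v. isotropic_normal_density \<sigma> (v - a) * d v)"
  shows "(LINT v|lborel. isotropic_normal_density \<sigma> (v - a) * ((v - a) \<bullet> F v)) =
     \<sigma>\<^sup>2 * (LINT v|lborel. isotropic_normal_density \<sigma> (v - a) * d v)"
proof -
  let ?g = "\<lambda>v. isotropic_normal_density \<sigma> (v - a)"
  define c :: "nat \<Rightarrow> real" where "c n = inverse (real (Suc n))" for n
  define h where "h p n v = flat_exp p (1 - c n * (norm (v - a))\<^sup>2)" for p n and v :: "real ^ 'q"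
  have c: "c n > 0" "c n \<le> 1" "c \<longlonglongrightarrow> 0" for n
    using LIMSEQ_inverse_real_of_nat by (auto simp: c_def[abs_def] field_simps)
  obtain C0 where C0: "C0 \<ge> 0" "\<And>t. t \<le> 1 \<Longrightarrow> \<bar>flat_exp 1 t\<bar> \<le> C0"
    using flat_exp_bounded by blast
  obtain C1 where C1: "C1 \<ge> 0" "\<And>t. t \<le> 1 \<Longrightarrow> \<bar>flat_exp (flat_exp_deriv 1) t\<bar> \<le> C1"
    using flat_exp_bounded by blast
  have arg: "1 - c n * (norm (v - a))\<^sup>2 \<le> 1" for n and v
    using c(1)[of n] by simp
  have lim_h: "(\<lambda>n. h p n v) \<longlonglongrightarrow> flat_exp p 1" for p v
  proof -
    have "(\<lambda>n. 1 - c n * (norm (v - a))\<^sup>2) \<longlonglongrightarrow> 1 - 0 * (norm (v - a))\<^sup>2"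
      by (intro tendsto_intros c)
    then show ?thesis
      unfolding h_def using continuous_flat_exp[of UNIV p]
      by (intro isCont_tendsto_compose[of _ "flat_exp p"]) (auto simp: continuous_on_eq_continuous_at)
  qed
  have [measurable]: "h p n \<in> borel_measurable borel" for p n
    unfolding h_def
    by (intro borel_measurable_continuous_onI continuous_on_compose2[OF continuous_flat_exp[of UNIV]]
        continuous_intros) auto
  let ?u = "\<lambda>n v. ?g v * ((v - a) \<bullet> F v) * (- h 1 n v / \<sigma>\<^sup>2 - 2 * c n * h (flat_exp_deriv 1) n v)"
  let ?w = "\<lambda>n v. ?g v * d v * h 1 n v"
  have identity: "(LINT v|lborel. ?u n v) = - (LINT v|lborel. ?w n v)" for n
  proof -
    have u: "F v \<bullet> (\<chi> j. partial_deriv j (gaussian_cutoff \<sigma> a (c n)) v) = ?u n v" for v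
      by (simp add: partial_deriv_gaussian_cutoff[OF \<sigma>] inner_vec_def sum_distrib_left
          sum_distrib_right h_def mult_ac)
    have w: "d v * gaussian_cutoff \<sigma> a (c n) v = ?w n v" for v
      by (simp add: gaussian_cutoff_def h_def)
    have "(LINT v|lborel. F v \<bullet> (\<chi> j. partial_deriv j (gaussian_cutoff \<sigma> a (c n)) v)) =
        - (LINT v|lborel. d v * gaussian_cutoff \<sigma> a (c n) v)"
      using F test_function_gaussian_cutoff[OF c(1)[of n], of \<sigma> a]
      by (simp add: has_weak_divergence_def)
    then show ?thesis unfolding u w .
  qed
  have lim_u: "(\<lambda>n. LINT v|lborel. ?u n v) \<longlonglongrightarrow>
      (LINT v|lborel. ?g v * ((v - a) \<bullet> F v) * (- flat_exp 1 1 / \<sigma>\<^sup>2 - 2 * 0 * flat_exp (flat_exp_deriv 1) 1))"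
  proof (rule integral_dominated_convergence
      [where w = "\<lambda>v. \<bar>?g v * ((v - a) \<bullet> F v)\<bar> * (C0 / \<sigma>\<^sup>2 + 2 * C1)"])
    show "AE v in lborel. (\<lambda>n. ?u n v) \<longlonglongrightarrow>
        ?g v * ((v - a) \<bullet> F v) * (- flat_exp 1 1 / \<sigma>\<^sup>2 - 2 * 0 * flat_exp (flat_exp_deriv 1) 1)"
      using \<sigma> by (intro AE_I2 tendsto_intros lim_h c) auto
    show "AE v in lborel. norm (?u n v) \<le>
        \<bar>?g v * ((v - a) \<bullet> F v)\<bar> * (C0 / \<sigma>\<^sup>2 + 2 * C1)" for n
    proof (intro AE_I2)
      fix v
      have "\<bar>h 1 n v / \<sigma>\<^sup>2\<bar> \<le> C0 / \<sigma>\<^sup>2"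
        using C0(2)[OF arg] by (simp add: h_def divide_right_mono)
      moreover have "\<bar>2 * c n * h (flat_exp_deriv 1) n v\<bar> \<le> 2 * (1 * C1)"
        using mult_mono[OF c(2)[of n] C1(2)[OF arg[of n v]]] c(1)[of n]
        by (simp add: h_def abs_mult)
      ultimately have "\<bar>- h 1 n v / \<sigma>\<^sup>2 - 2 * c n * h (flat_exp_deriv 1) n v\<bar> \<le> C0 / \<sigma>\<^sup>2 + 2 * C1"
        by linarith
      then show "norm (?u n v) \<le> \<bar>?g v * ((v - a) \<bullet> F v)\<bar> * (C0 / \<sigma>\<^sup>2 + 2 * C1)"
        unfolding real_norm_def abs_mult by (intro mult_left_mono) auto
    qed
  qed (use borel_measurable_integrable[OF int_F] int_F in \<open>auto intro!: integrable_mult_left\<close>)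
  have lim_w: "(\<lambda>n. LINT v|lborel. ?w n v) \<longlonglongrightarrow> (LINT v|lborel. ?g v * d v * flat_exp 1 1)"
  proof (rule integral_dominated_convergence[where w = "\<lambda>v. \<bar>?g v * d v\<bar> * C0"])
    show "AE v in lborel. (\<lambda>n. ?w n v) \<longlonglongrightarrow> ?g v * d v * flat_exp 1 1"
      by (intro AE_I2 tendsto_intros lim_h)
    show "AE v in lborel. norm (?w n v) \<le> \<bar>?g v * d v\<bar> * C0" for n
      unfolding real_norm_def abs_mult h_def
      by (intro AE_I2 mult_left_mono C0(2) arg) auto
  qed (use borel_measurable_integrable[OF int_d] int_d in \<open>auto intro!: integrable_mult_left\<close>)
  have "(LINT v|lborel. ?g v * ((v - a) \<bullet> F v) *
        (- flat_exp 1 1 / \<sigma>\<^sup>2 - 2 * 0 * flat_exp (flat_exp_deriv 1) 1)) =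
      - (LINT v|lborel. ?g v * d v * flat_exp 1 1)"
    by (rule LIMSEQ_unique[OF lim_u[unfolded identity] tendsto_minus[OF lim_w]])
  then have eq: "(LINT v|lborel. ?g v * ((v - a) \<bullet> F v)) * (- flat_exp 1 1 / \<sigma>\<^sup>2) =
      - ((LINT v|lborel. ?g v * d v) * flat_exp 1 1)"
    by simp
  have pos: "flat_exp 1 1 > 0"
    by (simp add: flat_exp_def)
  \<comment> \<open>Cancelling the limit of the cutoff is an identity of real numbers, isolated from the integrals.\<close>
  have solve: "I = s * D" if "I * (- f / s) = - (D * f)" "f > 0" "s > 0" for I D f s :: real
    using that by (simp add: field_simps)
  show ?thesis
    by (rule solve[OF eq pos]) (use \<sigma> in simp)
qed

section \<open>Moments of the isotropic normal distribution\<close>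

text \<open>
  Fubini for product functions, read off from the construction of Lebesgue measure on a Euclidean
  space as the product of one copy of the line for each basis vector.
\<close>

lemma has_bochner_integral_lborel_prod_components:
  fixes f :: "'q::finite \<Rightarrow> real \<Rightarrow> real"
  assumes int: "\<And>i. integrable lborel (f i)"
  shows "has_bochner_integral lborel (\<lambda>v :: real ^ 'q. \<Prod>i\<in>UNIV. f i (v $ i))
     (\<Prod>i\<in>UNIV. LINT x|lborel. f i x)"
proof -
  interpret product_sigma_finite "\<lambda>b :: real ^ 'q. lborel :: real measure" ..
  let ?B = "Basis :: (real ^ 'q) set"
  let ?T = "\<lambda>x. \<Sum>b\<in>?B. x b *\<^sub>R b"
  have [measurable]: "f i \<in> borel_measurable borel" for i
    using borel_measurable_integrable[OF int] by simp
  have reindex: "(\<Prod>b\<in>?B. h b) = (\<Prod>i\<in>UNIV. h (axis i 1))" for h :: "real ^ 'q \<Rightarrow> real"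
  proof -
    have B: "?B = range (\<lambda>i. axis i 1)"
      by (auto simp: Basis_vec_def)
    have "inj (\<lambda>i :: 'q. axis i (1 :: real))"
      by (auto simp: inj_def axis_eq_axis)
    from prod.reindex[OF this, of h] show ?thesis
      unfolding B by (simp add: comp_def)
  qed
  have T: "?T x $ i = x (axis i 1)" for x i
  proof -
    have "?T x $ i = ?T x \<bullet> axis i 1"
      by (simp add: inner_axis)
    also have "\<dots> = (\<Sum>b\<in>?B. x b * (if b = axis i 1 then 1 else 0))"
      unfolding inner_sum_left by (intro sum.cong) (auto simp: inner_axis_axis axis_eq_axis Basis_vec_def)
    also have "\<dots> = x (axis i 1)"
      by (auto simp: if_distrib[where f = "\<lambda>t. _ * t"] Basis_vec_def cong: if_cong)
    finally show ?thesis .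
  qed
  have Tm: "?T \<in> measurable (\<Pi>\<^sub>M b\<in>?B. lborel) borel"
    by measurable
  have prod_T: "(\<Prod>i\<in>UNIV. f i (?T x $ i)) = (\<Prod>b\<in>?B. f (axis_index b) (x b))" for x
    unfolding T reindex by (simp add: axis_index_axis)
  have intB: "integrable lborel (f (axis_index b))" for b :: "real ^ 'q"
    by (rule int)
  have meas: "(\<lambda>v :: real ^ 'q. \<Prod>i\<in>UNIV. f i (v $ i)) \<in> borel_measurable borel"
    by measurable
  have "integrable lborel (\<lambda>v :: real ^ 'q. \<Prod>i\<in>UNIV. f i (v $ i))"
    by (subst lborel_eq, subst integrable_distr_eq[OF Tm meas], unfold prod_T)
       (intro product_integrable_prod finite_Basis intB)
  moreover have "(LINT v :: real ^ 'q|lborel. (\<Prod>i\<in>UNIV. f i (v $ i))) =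
      (\<Prod>i\<in>UNIV. LINT x|lborel. f i x)"
  proof -
    have "(LINT v :: real ^ 'q|lborel. (\<Prod>i\<in>UNIV. f i (v $ i))) =
        (\<Prod>b\<in>?B. LINT x|lborel. f (axis_index b) x)"
      by (subst lborel_eq, subst integral_distr[OF Tm meas], unfold prod_T)
         (intro product_integral_prod finite_Basis intB)
    then show ?thesis
      by (simp add: reindex axis_index_axis)
  qed
  ultimately show ?thesis
    by (simp add: has_bochner_integral_iff)
qed

lemma isotropic_normal_density_eq_prod:
  assumes "\<sigma> > 0"
  shows "isotropic_normal_density \<sigma> (v :: real ^ 'q::finite) =
     (\<Prod>i\<in>UNIV. normal_density 0 \<sigma> (v $ i))"
proof -
  have "(\<Prod>i\<in>UNIV. exp (- (v $ i)\<^sup>2 / (2 * \<sigma>\<^sup>2))) = exp (- (norm v)\<^sup>2 / (2 * \<sigma>\<^sup>2))"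
    unfolding power2_norm_eq_inner inner_vec_def
    by (simp add: exp_sum[symmetric] sum_negf sum_divide_distrib[symmetric] power2_eq_square)
  moreover have "(\<Prod>i\<in>UNIV. normal_density 0 \<sigma> (v $ i)) =
      (\<Prod>i\<in>UNIV. exp (- (v $ i)\<^sup>2 / (2 * \<sigma>\<^sup>2))) / sqrt (2 * pi * \<sigma>\<^sup>2) ^ CARD('q)"
    by (simp add: normal_density_def prod_dividef)
  ultimately show ?thesis
    unfolding isotropic_normal_density_def by simp
qed

text \<open>
  The density is a product over the coordinates, so all moments reduce to those on the line.
  The exponent function \<open>m\<close> covers the first and second moments below uniformly.
\<close>

lemma isotropic_normal_monomial_moment:
  fixes m :: "'q::finite \<Rightarrow> nat"
  assumes "\<sigma> > 0"
  shows "has_bochner_integral lborel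
     (\<lambda>v. isotropic_normal_density \<sigma> v * (\<Prod>i\<in>UNIV. (v $ i) ^ m i))
     (\<Prod>i\<in>UNIV. LINT x|lborel. normal_density 0 \<sigma> x * x ^ m i)"
  using has_bochner_integral_lborel_prod_components
      [of "\<lambda>i x. normal_density 0 \<sigma> x * x ^ m i"] integrable_normal_moment[OF assms, of 0] assms
  by (simp add: isotropic_normal_density_eq_prod prod.distrib)

lemma prod_power_of_bool:
  "(\<Prod>i\<in>UNIV. (f i :: real) ^ of_bool (i = j)) = f (j :: 'q::finite)"
proof -
  have "(\<Prod>i\<in>UNIV. f i ^ of_bool (i = j)) = (\<Prod>i\<in>UNIV. if i = j then f i else 1)"
    by (intro prod.cong) auto
  then show ?thesis by simp
qed

lemma isotropic_normal_first_moment: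
  fixes j :: "'q::finite"
  assumes "\<sigma> > 0"
  shows "has_bochner_integral lborel (\<lambda>v. isotropic_normal_density \<sigma> v * v $ j) 0"
proof -
  have "(LINT x|lborel. normal_density 0 \<sigma> x * x ^ of_bool (j = j)) = 0"
    using normal_moment_nz_1[OF assms, of 0] by (simp add: has_bochner_integral_iff)
  then have "(\<Prod>i\<in>UNIV. LINT x|lborel. normal_density 0 \<sigma> x * x ^ of_bool (i = j)) = 0"
    by (intro prod_zero) auto
  then show ?thesis
    using isotropic_normal_monomial_moment[OF assms, of "\<lambda>i. of_bool (i = j)"]
    by (simp only: prod_power_of_bool)
qed

lemma isotropic_normal_second_moment:
  fixes j k :: "'q::finite"
  assumes "\<sigma> > 0"
  shows "has_bochner_integral lborel (\<lambda>v. isotropic_normal_density \<sigma> v * (v $ j * v $ k))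
     (\<sigma>\<^sup>2 * of_bool (j = k))"
proof -
  \<comment> \<open>Adding the two indicators yields exponent 2 if the indices agree and two exponents 1 otherwise.\<close>
  let ?I = "\<lambda>i. LINT x|lborel. normal_density 0 \<sigma> x * x ^ (of_bool (i = j) + of_bool (i = k))"
  have "(\<Prod>i\<in>UNIV. ?I i) = \<sigma>\<^sup>2 * of_bool (j = k)"
  proof (cases "j = k")
    case True
    have "?I i = (if i = k then \<sigma>\<^sup>2 else 1)" for i
      using normal_moment_even[OF assms, of 0 1] True integral_normal_density[OF assms, of 0]
      by (simp add: has_bochner_integral_iff numeral_2_eq_2)
    then show ?thesis using True by simp
  next
    case False
    then have "?I j = 0"
      using normal_moment_nz_1[OF assms, of 0] by (simp add: has_bochner_integral_iff)
    then have "(\<Prod>i\<in>UNIV. ?I i) = 0"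
      by (intro prod_zero) auto
    then show ?thesis using False by simp
  qed
  then show ?thesis
    using isotropic_normal_monomial_moment[OF assms, of "\<lambda>i. of_bool (i = j) + of_bool (i = k)"]
    by (simp only: power_add prod.distrib prod_power_of_bool)
qed

lemma distributed_has_bochner_integral:
  fixes f g :: "'a \<Rightarrow> real"
  assumes "distributed M N X (\<lambda>v. ennreal (f v))" and "\<And>v. f v \<ge> 0"
    and "g \<in> borel_measurable N"
  shows "has_bochner_integral M (\<lambda>\<omega>. g (X \<omega>)) c \<longleftrightarrow> has_bochner_integral N (\<lambda>v. f v * g v) c"
  using distributed_integrable[OF assms(1,3)] distributed_integral[OF assms(1,3)] assms(2)
  by (simp add: has_bochner_integral_iff)

lemma distributed_lborel_shift:
  fixes w :: "'w \<Rightarrow> 'a::euclidean_space"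
  assumes "distributed M lborel w f"
  shows "distributed M lborel (\<lambda>\<omega>. a + w \<omega>) (\<lambda>v. f (v - a))"
proof -
  have w [measurable]: "w \<in> measurable M borel" and f [measurable]: "f \<in> borel_measurable borel"
    and dw: "distr M lborel w = density lborel f"
    using assms by (auto simp: distributed_def)
  have "distr M lborel (\<lambda>\<omega>. a + w \<omega>) = distr (distr M lborel w) lborel ((+) a)"
    by (simp add: distr_distr comp_def)
  also have "\<dots> = distr (density lborel (\<lambda>v. f (a + v - a))) lborel ((+) a)"
    by (simp add: dw)
  also have "\<dots> = density (distr lborel lborel ((+) a)) (\<lambda>v. f (v - a))"
    by (rule density_distr[symmetric]) auto
  also have "distr lborel lborel ((+) a) = lborel"
    using lborel_distr_plus[of a] by (simp cong: distr_cong)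
  finally show ?thesis
    by (simp add: distributed_def)
qed

lemma isotropic_normal_linear_image_moments:
  fixes w :: "'w \<Rightarrow> real ^ 'q::finite" and A :: "real ^ 'q ^ 'm::finite"
  assumes \<sigma>: "\<sigma> > 0"
    and w: "distributed M lborel w (\<lambda>v. ennreal (isotropic_normal_density \<sigma> v))"
  shows "has_bochner_integral M (\<lambda>\<omega>. (A *v w \<omega>) $ i) 0"
    and "has_bochner_integral M (\<lambda>\<omega>. (norm (A *v w \<omega>))\<^sup>2) (\<sigma>\<^sup>2 * trace (transpose A ** A))"
proof -
  note transfer = distributed_has_bochner_integral[OF w isotropic_normal_density_nonneg, THEN iffD2]
  have m1: "has_bochner_integral M (\<lambda>\<omega>. w \<omega> $ j) 0" for j
    by (rule transfer) (simp, rule isotropic_normal_first_moment[OF \<sigma>])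
  have m2: "has_bochner_integral M (\<lambda>\<omega>. w \<omega> $ j * w \<omega> $ k) (\<sigma>\<^sup>2 * of_bool (j = k))" for j k
    by (rule transfer) (simp, rule isotropic_normal_second_moment[OF \<sigma>])
  have "has_bochner_integral M (\<lambda>\<omega>. \<Sum>j\<in>UNIV. A $ i $ j * w \<omega> $ j) (\<Sum>j\<in>UNIV. A $ i $ j * 0)"
    by (intro has_bochner_integral_sum has_bochner_integral_mult_right m1)
  then show "has_bochner_integral M (\<lambda>\<omega>. (A *v w \<omega>) $ i) 0"
    by (simp add: matrix_vector_mult_def)
  have "has_bochner_integral M
      (\<lambda>\<omega>. \<Sum>i\<in>UNIV. \<Sum>j\<in>UNIV. \<Sum>k\<in>UNIV. A $ i $ j * A $ i $ k * (w \<omega> $ j * w \<omega> $ k))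
      (\<Sum>i\<in>UNIV. \<Sum>j\<in>UNIV. \<Sum>k\<in>UNIV. A $ i $ j * A $ i $ k * (\<sigma>\<^sup>2 * of_bool (j = k)))"
    by (intro has_bochner_integral_sum has_bochner_integral_mult_right m2)
  moreover have "(norm (A *v v))\<^sup>2 =
      (\<Sum>i\<in>UNIV. \<Sum>j\<in>UNIV. \<Sum>k\<in>UNIV. A $ i $ j * A $ i $ k * (v $ j * v $ k))" for v
    by (simp add: power2_norm_eq_inner inner_vec_def matrix_vector_mult_def sum_product mult_ac)
  moreover have "(\<Sum>i\<in>UNIV. \<Sum>j\<in>UNIV. \<Sum>k\<in>UNIV. A $ i $ j * A $ i $ k * (\<sigma>\<^sup>2 * of_bool (j = k))) =
      \<sigma>\<^sup>2 * trace (transpose A ** A)"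
  proof -
    have "(\<Sum>k\<in>UNIV. A $ i $ j * A $ i $ k * (\<sigma>\<^sup>2 * of_bool (j = k))) = \<sigma>\<^sup>2 * (A $ i $ j * A $ i $ j)"
      for i j by (simp add: of_bool_def if_distrib cong: if_cong)
    then show ?thesis
      unfolding trace_def matrix_matrix_mult_def transpose_def
      by (simp add: sum_distrib_left sum.swap[of _ "UNIV :: 'm set"])
  qed
  ultimately show "has_bochner_integral M (\<lambda>\<omega>. (norm (A *v w \<omega>))\<^sup>2) (\<sigma>\<^sup>2 * trace (transpose A ** A))"
    by simp
qed

lemma trace_conjugate_eq:
  fixes A :: "real ^ 'q::finite ^ 'm::finite"
  shows "trace (A ** B ** transpose A) = trace (transpose A ** A ** B)"
  using trace_mul_sym[of "A ** B" "transpose A"] by (simp add: matrix_mul_assoc)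

lemma inner_gram_matrix:
  fixes A :: "real ^ 'q::finite ^ 'm::finite"
  shows "u \<bullet> ((transpose A ** A) *v z) = (A *v u) \<bullet> (A *v z)"
  by (metis dot_lmul_matrix inner_commute matrix_vector_mul_assoc transpose_matrix_vector)

section \<open>Unbiasedness of the risk estimate\<close>

theorem theorem3:
  fixes \<Phi> :: "real ^ 'n ^ 'q" and x\<^sub>0 :: "real ^ 'n" and \<mu>\<^sub>0 :: "real ^ 'q" and \<sigma> :: real
    and x :: "'t \<Rightarrow> real ^ 'q \<Rightarrow> real ^ 'n" and \<theta> :: 't
    and \<mu> :: "'t \<Rightarrow> real ^ 'q \<Rightarrow> real ^ 'q" and J :: "real ^ 'q \<Rightarrow> real ^ 'q ^ 'q"
    and A :: "real ^ 'q ^ 'm"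
    and M :: "'w measure" and w y :: "'w \<Rightarrow> real ^ 'q"
  assumes sigma: "\<sigma> > 0"
    and mu0: "\<mu>\<^sub>0 = \<Phi> *v x\<^sub>0"
    and mu: "\<And>v. \<mu> \<theta> v = \<Phi> *v x \<theta> v"
    and weakly_differentiable: "has_weak_jacobian (\<mu> \<theta>) J"
    and prob: "prob_space M"
    and noise: "distributed M lborel w (\<lambda>v. ennreal (isotropic_normal_density \<sigma> v))"
    and observation: "\<And>\<omega>. y \<omega> = \<mu>\<^sub>0 + w \<omega>"
    and df_hat_expectation_exists: "integrable M (\<lambda>\<omega>. df_hat A J (y \<omega>))"
    and cov_exists:
      "\<And>i. integrable M (\<lambda>\<omega>. (A *v \<mu> \<theta> (y \<omega>)) $ i)"
      "\<And>i. integrable M (\<lambda>\<omega>. (A *v y \<omega>) $ i * (A *v \<mu> \<theta> (y \<omega>)) $ i)"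
  shows "(LINT \<omega>|M. GSURE \<sigma> A (\<mu> \<theta>) J (y \<omega>)) =
           (LINT \<omega>|M. (norm (A *v \<mu>\<^sub>0 - A *v \<mu> \<theta> (y \<omega>)))\<^sup>2) \<and>
         (LINT \<omega>|M. df_hat A J (y \<omega>)) = df \<sigma> A (\<mu> \<theta>) M y"
proof -
  let ?g = "\<lambda>v. isotropic_normal_density \<sigma> (v - \<mu>\<^sub>0)"
  let ?Y = "\<lambda>\<omega>. A *v \<mu> \<theta> (y \<omega>)"
  define B where "B = transpose A ** A"
  define F where "F v = B *v \<mu> \<theta> v" for v
  have df_hat: "df_hat A J v = trace (B ** J v)" for v
    by (simp add: df_hat_def B_def trace_conjugate_eq)
  have div: "has_weak_divergence F (df_hat A J)"
    using has_weak_jacobian_imp_has_weak_divergence[OF weakly_differentiable, of B]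
    by (simp add: F_def[abs_def] df_hat[abs_def])
  note meas = has_weak_divergence_measurable[OF div]
  have y: "distributed M lborel y (\<lambda>v. ennreal (?g v))"
  proof -
    have "y = (\<lambda>\<omega>. \<mu>\<^sub>0 + w \<omega>)"
      using observation by auto
    then show ?thesis
      using distributed_lborel_shift[OF noise, of \<mu>\<^sub>0] by simp
  qed

  note first = isotropic_normal_linear_image_moments(1)[OF sigma noise, of A]
  note second = isotropic_normal_linear_image_moments(2)[OF sigma noise, of A]
  have Ay: "A *v y \<omega> = A *v \<mu>\<^sub>0 + A *v w \<omega>" for \<omega>
    by (simp add: observation matrix_vector_right_distrib)
  have int_noise_Y: "integrable M (\<lambda>\<omega>. (A *v w \<omega>) $ i * ?Y \<omega> $ i)" for i
  proof -
    have "integrable M (\<lambda>\<omega>. (A *v y \<omega>) $ i * ?Y \<omega> $ i - (A *v \<mu>\<^sub>0) $ i * ?Y \<omega> $ i)"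
      by (intro Bochner_Integration.integrable_diff integrable_mult_right cov_exists)
    then show ?thesis by (simp add: Ay algebra_simps)
  qed
  have noise_F: "(y \<omega> - \<mu>\<^sub>0) \<bullet> F (y \<omega>) = (\<Sum>i\<in>UNIV. (A *v w \<omega>) $ i * ?Y \<omega> $ i)" for \<omega>
    unfolding F_def B_def inner_gram_matrix by (simp add: observation inner_vec_def)

  have stein: "(LINT \<omega>|M. (y \<omega> - \<mu>\<^sub>0) \<bullet> F (y \<omega>)) = \<sigma>\<^sup>2 * (LINT \<omega>|M. df_hat A J (y \<omega>))"
  proof -
    have mF: "(\<lambda>v. (v - \<mu>\<^sub>0) \<bullet> F v) \<in> borel_measurable lborel"
      using meas by simp
    have md: "df_hat A J \<in> borel_measurable lborel"
      using meas by simp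
    have "integrable M (\<lambda>\<omega>. (y \<omega> - \<mu>\<^sub>0) \<bullet> F (y \<omega>))"
      unfolding noise_F by (intro Bochner_Integration.integrable_sum int_noise_Y)
    then have "integrable lborel (\<lambda>v. ?g v * ((v - \<mu>\<^sub>0) \<bullet> F v))"
      using distributed_integrable[OF y mF] isotropic_normal_density_nonneg by auto
    moreover have "integrable lborel (\<lambda>v. ?g v * df_hat A J v)"
      using distributed_integrable[OF y md] isotropic_normal_density_nonneg
        df_hat_expectation_exists by auto
    ultimately have "(LINT v|lborel. ?g v * ((v - \<mu>\<^sub>0) \<bullet> F v)) =
        \<sigma>\<^sup>2 * (LINT v|lborel. ?g v * df_hat A J v)"
      by (rule weak_stein_identity[OF sigma div])
    then show ?thesis
      by (simp add: distributed_integral[OF y mF] distributed_integral[OF y md]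
          isotropic_normal_density_nonneg)
  qed

  have cov_eq: "cov M (\<lambda>\<omega>. (A *v y \<omega>) $ i) (\<lambda>\<omega>. ?Y \<omega> $ i) =
      (LINT \<omega>|M. (A *v w \<omega>) $ i * ?Y \<omega> $ i)" for i
  proof -
    interpret prob_space M by (rule prob)
    have mean: "(LINT \<omega>|M. (A *v y \<omega>) $ i) = (A *v \<mu>\<^sub>0) $ i"
      using first[of i] by (simp add: Ay has_bochner_integral_iff prob_space)
    let ?e = "LINT \<omega>|M. ?Y \<omega> $ i"
    have "cov M (\<lambda>\<omega>. (A *v y \<omega>) $ i) (\<lambda>\<omega>. ?Y \<omega> $ i) =
        (LINT \<omega>|M. (A *v w \<omega>) $ i * ?Y \<omega> $ i - (A *v w \<omega>) $ i * ?e)"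
      unfolding cov_def mean by (simp add: Ay right_diff_distrib)
    also have "\<dots> = (LINT \<omega>|M. (A *v w \<omega>) $ i * ?Y \<omega> $ i)"
      using first[of i] int_noise_Y[of i]
      by (subst Bochner_Integration.integral_diff) (auto simp: has_bochner_integral_iff)
    finally show ?thesis .
  qed
  have df_eq: "df \<sigma> A (\<mu> \<theta>) M y = (LINT \<omega>|M. df_hat A J (y \<omega>))"
  proof -
    have "df \<sigma> A (\<mu> \<theta>) M y = (LINT \<omega>|M. (y \<omega> - \<mu>\<^sub>0) \<bullet> F (y \<omega>)) / \<sigma>\<^sup>2"
      unfolding noise_F df_def cov_eq
      by (simp add: Bochner_Integration.integral_sum int_noise_Y sum_divide_distrib)
    then show ?thesis using sigma by (simp add: stein)
  qed

  \<comment> \<open>\<open>N\<close> is the true loss, and \<open>Z\<close> collects everything by which the risk estimate deviates from it.\<close>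
  define N where "N \<omega> = (norm (A *v \<mu>\<^sub>0 - ?Y \<omega>))\<^sup>2" for \<omega>
  define Z where "Z \<omega> = (norm (A *v w \<omega>))\<^sup>2 + 2 * (\<Sum>i\<in>UNIV. (A *v w \<omega>) $ i * (A *v \<mu>\<^sub>0) $ i)
    - 2 * ((y \<omega> - \<mu>\<^sub>0) \<bullet> F (y \<omega>)) - \<sigma>\<^sup>2 * trace B + 2 * \<sigma>\<^sup>2 * df_hat A J (y \<omega>)" for \<omega>
  have GSURE: "GSURE \<sigma> A (\<mu> \<theta>) J (y \<omega>) = N \<omega> + Z \<omega>" for \<omega>
  proof -
    have "A *v (y \<omega> - \<mu> \<theta> (y \<omega>)) = (A *v \<mu>\<^sub>0 - ?Y \<omega>) + A *v w \<omega>"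
      by (simp add: matrix_vector_mult_diff_distrib Ay)
    then have "(norm (A *v (y \<omega> - \<mu> \<theta> (y \<omega>))))\<^sup>2 =
        N \<omega> + (norm (A *v w \<omega>))\<^sup>2 + 2 * ((A *v w \<omega>) \<bullet> (A *v \<mu>\<^sub>0)) - 2 * ((A *v w \<omega>) \<bullet> ?Y \<omega>)"
      by (simp add: N_def power2_norm_eq_inner inner_add_left inner_add_right
          inner_diff_left inner_diff_right inner_commute)
    then show ?thesis
      unfolding GSURE_def Z_def noise_F B_def by (simp add: inner_vec_def)
  qed
  have Z: "has_bochner_integral M Z 0"
  proof -
    interpret prob_space M by (rule prob)
    let ?d = "LINT \<omega>|M. df_hat A J (y \<omega>)"
    have "has_bochner_integral M (\<lambda>\<omega>. (y \<omega> - \<mu>\<^sub>0) \<bullet> F (y \<omega>)) (\<sigma>\<^sup>2 * ?d)"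
      unfolding has_bochner_integral_iff stein[symmetric] noise_F
      by (simp add: Bochner_Integration.integrable_sum int_noise_Y)
    moreover have "has_bochner_integral M (\<lambda>\<omega>. df_hat A J (y \<omega>)) ?d"
      using df_hat_expectation_exists by (simp add: has_bochner_integral_iff)
    moreover have "has_bochner_integral M (\<lambda>\<omega>. trace B) (trace B)"
      by (simp add: has_bochner_integral_iff prob_space)
    moreover have "has_bochner_integral M (\<lambda>\<omega>. \<Sum>i\<in>UNIV. (A *v w \<omega>) $ i * (A *v \<mu>\<^sub>0) $ i)
        (\<Sum>i\<in>UNIV. 0 * (A *v \<mu>\<^sub>0) $ i)"
      by (intro has_bochner_integral_sum has_bochner_integral_mult_left first)
    ultimately have "has_bochner_integral M Z
        (\<sigma>\<^sup>2 * trace B + 2 * (\<Sum>i\<in>UNIV. 0 * (A *v \<mu>\<^sub>0) $ i)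
          - 2 * (\<sigma>\<^sup>2 * ?d) - \<sigma>\<^sup>2 * trace B + 2 * \<sigma>\<^sup>2 * ?d)"
      unfolding Z_def[abs_def] B_def
      by (intro has_bochner_integral_add has_bochner_integral_diff
          has_bochner_integral_mult_right second)
    then show ?thesis by simp
  qed
  \<comment> \<open>The loss need not have finite expectation; if it has none, neither has the risk estimate, and both integrals are \<open>0\<close>.\<close>
  have "(LINT \<omega>|M. N \<omega> + Z \<omega>) = (LINT \<omega>|M. N \<omega>)"
  proof (cases "integrable M N")
    case True
    then show ?thesis using Z by (simp add: has_bochner_integral_iff)
  next
    case False
    have "\<not> integrable M (\<lambda>\<omega>. N \<omega> + Z \<omega>)"
    proof
      assume "integrable M (\<lambda>\<omega>. N \<omega> + Z \<omega>)"
      then have "integrable M (\<lambda>\<omega>. (N \<omega> + Z \<omega>) - Z \<omega>)"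
        using Z by (intro Bochner_Integration.integrable_diff) (auto simp: has_bochner_integral_iff)
      with False show False by simp
    qed
    with False show ?thesis by (simp add: not_integrable_integral_eq)
  qed
  with df_eq show ?thesis
    by (simp add: GSURE N_def)
qed

end
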